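(* For all nonnegative integers $r,s,i$ and every nonnegative integer $j\le r+1$, the extended Wichmann ruler $w_1(r,s,i,j)$ is a complete sparse ruler.
   Context: A sparse ruler of length $n$ is a subset $R\subseteq\{0,\dots,n\}$ containing $0$ and $n$; it is complete if every $d\in\{0,\dots,n\}$ equals $|x-y|$ for some $x,y\in R$. A finite sequence $(b_1,\dots,b_k)$ of nonnegative integers (difference representation) determines the ruler $\{0,\,b_1,\,b_1+b_2,\,\dots,\,b_1+\cdots+b_k\}$, of length $b_1+\cdots+b_k$. Writing $a^t$ for $t$ consecutive copies of $a$, the extended Wichmann ruler $w_1(r,s,i,j)$ is the ruler with difference representation $$(1^r,\ r+1,\ (2r+1)^r,\ (4r+3)^s,\ (2r+2)^{r+1},\ 1^r,\ (r+1)^i,\ j).$$ *)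

theory Defs
  imports Main
begin

definition sparse_ruler :: "nat \<Rightarrow> nat set \<Rightarrow> bool" where
  "sparse_ruler n R \<longleftrightarrow> R \<subseteq> {0..n} \<and> 0 \<in> R \<and> n \<in> R"

(* The distance is taken in the integers because subtraction on nat truncates. *)
definition complete_sparse_ruler :: "nat \<Rightarrow> nat set \<Rightarrow> bool" where
  "complete_sparse_ruler n R \<longleftrightarrow>
     sparse_ruler n R \<and>
     (\<forall>d\<in>{0..n}. \<exists>x\<in>R. \<exists>y\<in>R. int d = \<bar>int x - int y\<bar>)"

(* The partial sums of a difference representation, including the empty sum 0. *)
definition ruler_of_diffs :: "nat list \<Rightarrow> nat set" where
  "ruler_of_diffs bs = {sum_list (take m bs) | m. m \<le> length bs}"

definition wichmann_diffs :: "nat \<Rightarrow> nat \<Rightarrow> nat \<Rightarrow> nat \<Rightarrow> nat list" where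
  "wichmann_diffs r s i j =
     replicate r 1 @ [r + 1] @ replicate r (2 * r + 1) @ replicate s (4 * r + 3) @
     replicate (r + 1) (2 * r + 2) @ replicate r 1 @ replicate i (r + 1) @ [j]"

definition extended_wichmann_ruler :: "nat \<Rightarrow> nat \<Rightarrow> nat \<Rightarrow> nat \<Rightarrow> nat set" where
  "extended_wichmann_ruler r s i j = ruler_of_diffs (wichmann_diffs r s i j)"

end

theory Submission
  imports Defs
begin

text \<open>
  Write \<open>m = r + 1\<close> and give a lattice point \<open>(x, y)\<close> the value \<open>(2m - 1) x + 2m y\<close>.
  Differences between the marks of the three middle blocks realise the value of every lattice
  point of the hexagon \<open>x, y \<le> s + m\<close>, \<open>\<bar>x - y\<bar> \<le> m\<close>. Measuring to the second run of unit
  steps adds any \<open>e \<le> r\<close> to the values on the upper boundary of the hexagon, and measuring from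
  the first run subtracts any \<open>e \<le> r\<close> from the values on the lower boundary. On an antidiagonal
  \<open>x + y = l\<close> the values \<open>2ml - x\<close> are consecutive integers, and the boundary intervals fill
  exactly the gaps between neighbouring antidiagonals. The steps \<open>r + 1\<close> and \<open>j\<close> at the end
  extend the measured range because the run \<open>0, \<dots>, r\<close> at the start of the ruler
  measures a whole window of \<open>r + 1\<close> lengths from each new mark.
\<close>

text \<open>Stated by addition, so that neither absolute values nor truncated subtraction enter the
  argument.\<close>

definition measures :: "nat set \<Rightarrow> nat \<Rightarrow> bool" where
  "measures R d \<longleftrightarrow> (\<exists>x\<in>R. x + d \<in> R)"

lemma measuresI: "\<lbrakk>x \<in> R; y \<in> R; x + d = y\<rbrakk> \<Longrightarrow> measures R d"
  by (auto simp: measures_def)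

lemma complete_sparse_rulerI:
  assumes "sparse_ruler n R" and "\<And>d. d \<le> n \<Longrightarrow> measures R d"
  shows "complete_sparse_ruler n R"
  unfolding complete_sparse_ruler_def
proof (intro conjI ballI)
  fix d assume "d \<in> {0..n}"
  then obtain x where "x \<in> R" "x + d \<in> R"
    using assms(2)[of d] by (auto simp: measures_def)
  then show "\<exists>x\<in>R. \<exists>y\<in>R. int d = \<bar>int x - int y\<bar>"
    by (intro bexI[of _ x] bexI[of _ "x + d"]) auto
qed (fact assms(1))

section \<open>Marks of a difference representation\<close>

lemma sum_list_take_mem: "m \<le> length bs \<Longrightarrow> sum_list (take m bs) \<in> ruler_of_diffs bs"
  by (auto simp: ruler_of_diffs_def)

lemma sparse_ruler_of_diffs: "sparse_ruler (sum_list bs) (ruler_of_diffs bs)"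
proof -
  have "sum_list (take m bs) \<le> sum_list bs" for m
    by (metis append_take_drop_id le_add1 sum_list_append)
  then show ?thesis
    using sum_list_take_mem[of 0 bs] sum_list_take_mem[of "length bs" bs]
    by (auto simp: sparse_ruler_def ruler_of_diffs_def)
qed

lemma ruler_of_diffs_prefix: "x \<in> ruler_of_diffs bs \<Longrightarrow> x \<in> ruler_of_diffs (bs @ cs)"
  unfolding ruler_of_diffs_def by (clarsimp, rule_tac x = m in exI) simp

lemma ruler_of_diffs_suffix:
  assumes "x \<in> ruler_of_diffs cs"
  shows "sum_list bs + x \<in> ruler_of_diffs (bs @ cs)"
proof -
  obtain m where "m \<le> length cs" "x = sum_list (take m cs)"
    using assms by (auto simp: ruler_of_diffs_def)
  then show ?thesis
    using sum_list_take_mem[of "length bs + m" "bs @ cs"] by simp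
qed

lemma ruler_of_diffs_replicate: "k \<le> n \<Longrightarrow> k * a \<in> ruler_of_diffs (replicate n a)"
  using sum_list_take_mem[of k "replicate n a"] by (simp add: sum_list_replicate)

lemma ruler_of_diffs_block:
  assumes "k \<le> n"
  shows "sum_list bs + k * a \<in> ruler_of_diffs (bs @ replicate n a @ cs)"
  using assms by (intro ruler_of_diffs_suffix ruler_of_diffs_prefix ruler_of_diffs_replicate)

text \<open>Index ranges include both ends of each block, so the last mark of a block is also the
  first of the next. The mark 0 opens both \<open>unit1\<close> and \<open>block1\<close>.\<close>

locale wichmann_marks =
  fixes r s :: nat and R :: "nat set"
  assumes unit1: "e \<le> r \<Longrightarrow> e \<in> R"
    and block1: "k \<le> r + 1 \<Longrightarrow> k * (2 * r + 1) \<in> R"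
    and block2: "c \<le> s \<Longrightarrow> (r + 1) * (2 * r + 1) + c * (4 * r + 3) \<in> R"
    and block3: "k \<le> r + 1 \<Longrightarrow>
      (r + 1) * (2 * r + 1) + s * (4 * r + 3) + k * (2 * r + 2) \<in> R"
    and unit2: "e \<le> r \<Longrightarrow>
      (r + 1) * (2 * r + 1) + s * (4 * r + 3) + (r + 1) * (2 * r + 2) + e \<in> R"
begin

section \<open>Lattice points of the hexagon and intervals at its boundary\<close>

lemma measures_hexagon:
  assumes "x \<le> s + r + 1" "y \<le> s + r + 1" "x \<le> y + r + 1" "y \<le> x + r + 1"
  shows "measures R ((2 * r + 1) * x + (2 * r + 2) * y)"
proof -
  \<comment> \<open>The three cases measure from block 1 to 2, from 2 to 3, and from 1 to 3. A step
    \<open>4 * r + 3\<close> of block 2 advances both coordinates by one.\<close>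
  consider "y \<le> x" "y \<le> s" | "x \<le> y" "x \<le> s" | "s \<le> x" "s \<le> y"
    by linarith
  then show ?thesis
  proof cases
    case 1
    define v where "v = x - y"
    define u where "u = r + 1 - v"
    have x: "x = y + v" and uv: "u + v = r + 1" and u_le: "u \<le> r + 1"
      using 1 assms by (auto simp: u_def v_def)
    have "u * (2 * r + 1) + v * (2 * r + 1) = (r + 1) * (2 * r + 1)"
      by (simp only: uv flip: add_mult_distrib)
    then show ?thesis
      using u_le 1 by (intro measuresI[OF block1[of u] block2[of y]]) (auto simp: x algebra_simps)
  next
    case 2
    define k where "k = y - x"
    define t where "t = s - x"
    have y: "y = x + k" and tx: "t + x = s" and k: "k \<le> r + 1"
      using 2 assms by (auto simp: k_def t_def)
    have "(t + x) * (4 * r + 3) = s * (4 * r + 3)" by (simp only: tx)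
    then show ?thesis
      using tx k by (intro measuresI[OF block2[of t] block3[of k]]) (auto simp: y algebra_simps)
  next
    case 3
    define v where "v = x - s"
    define u where "u = r + 1 - v"
    define k where "k = y - s"
    have x: "x = s + v" and y: "y = s + k" and uv: "u + v = r + 1" and u_le: "u \<le> r + 1" and k: "k \<le> r + 1"
      using 3 assms by (auto simp: u_def v_def k_def)
    have "u * (2 * r + 1) + v * (2 * r + 1) = (r + 1) * (2 * r + 1)"
      by (simp only: uv flip: add_mult_distrib)
    then show ?thesis
      using u_le k by (intro measuresI[OF block1[of u] block3[of k]]) (auto simp: x y algebra_simps)
  qed
qed

text \<open>Left edge \<open>x = 0\<close>. The two lemmas that follow treat the edges
  \<open>y = x + r + 1\<close> and \<open>y = s + r + 1\<close>.\<close>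

lemma measures_upper1:
  assumes "y \<le> r + 1" "e \<le> r"
  shows "measures R ((2 * r + 2) * y + e)"
proof -
  define k where "k = r + 1 - y"
  have ky: "k + y = r + 1" and k_le: "k \<le> r + 1" using assms by (simp_all add: k_def)
  have "k * (2 * r + 2) + y * (2 * r + 2) = (r + 1) * (2 * r + 2)"
      by (simp only: ky flip: add_mult_distrib)
  then show ?thesis
    using k_le assms by (intro measuresI[OF block3[of k] unit2[of e]]) (auto simp: algebra_simps)
qed

lemma measures_upper2:
  assumes "c \<le> s" "e \<le> r"
  shows "measures R ((2 * r + 1) * c + (2 * r + 2) * (r + 1 + c) + e)"
proof -
  define t where "t = s - c"
  have tc: "t + c = s" using assms by (simp add: t_def)
  have "(t + c) * (4 * r + 3) = s * (4 * r + 3)" by (simp only: tc)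
  then show ?thesis
    using tc assms by (intro measuresI[OF block2[of t] unit2[of e]]) (auto simp: algebra_simps)
qed

lemma measures_upper3:
  assumes "v \<le> r + 1" "e \<le> r"
  shows "measures R ((2 * r + 1) * (s + v) + (2 * r + 2) * (r + 1 + s) + e)"
proof -
  define u where "u = r + 1 - v"
  have uv: "u + v = r + 1" and u_le: "u \<le> r + 1" using assms by (simp_all add: u_def)
  have "u * (2 * r + 1) + v * (2 * r + 1) = (r + 1) * (2 * r + 1)"
      by (simp only: uv flip: add_mult_distrib)
  then show ?thesis
    using u_le assms by (intro measuresI[OF block1[of u] unit2[of e]]) (auto simp: algebra_simps)
qed

text \<open>Bottom edge \<open>y = 0\<close>, followed by the edges \<open>x = y + r + 1\<close> and
  \<open>x = s + r + 1\<close>.\<close>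

lemma measures_lower1:
  assumes "x \<le> r + 1" "e \<le> r" "e + d = (2 * r + 1) * x"
  shows "measures R d"
  using assms by (intro measuresI[OF unit1[of e] block1[of x]]) (auto simp: algebra_simps)

lemma measures_lower2:
  assumes "c \<le> s" "e \<le> r" "e + d = (2 * r + 1) * (r + 1 + c) + (2 * r + 2) * c"
  shows "measures R d"
  using assms by (intro measuresI[OF unit1[of e] block2[of c]]) (auto simp: algebra_simps)

lemma measures_lower3:
  assumes "k \<le> r + 1" "e \<le> r" "e + d = (2 * r + 1) * (r + 1 + s) + (2 * r + 2) * (s + k)"
  shows "measures R d"
  using assms by (intro measuresI[OF unit1[of e] block3[of k]]) (auto simp: algebra_simps)

section \<open>Sweep over the antidiagonals\<close>

lemma measures_diagonal:
  assumes "d + x = (2 * r + 2) * l" "x \<le> l"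
    and "x \<le> s + r + 1" "l \<le> x + s + r + 1" "2 * x \<le> l + r + 1" "l \<le> 2 * x + r + 1"
  shows "measures R d"
proof -
  define y where "y = l - x"
  have l: "l = x + y" using assms(2) by (simp add: y_def)
  have "d = (2 * r + 1) * x + (2 * r + 2) * y"
    using assms(1) by (simp add: l algebra_simps)
  then show ?thesis
    using measures_hexagon[of x y] assms(3-) by (simp add: l)
qed

lemma measures_sweep1:
  "l \<le> r + 1 \<Longrightarrow> d \<le> (2 * r + 2) * l + r \<Longrightarrow> measures R d"
proof (induction l)
  case 0
  then show ?case using measures_upper1[of 0 d] by simp
next
  case (Suc l)
  define H where "H = (2 * r + 2) * l"
  \<comment> \<open>\<open>H\<close>, \<open>T\<close> and \<open>V\<close> concern the points
    \<open>(0, l)\<close>, \<open>(0, l + 1)\<close> and \<open>(l + 1, 0)\<close>; \<open>V\<close>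
    adds \<open>l\<close> to avoid a subtraction. The new lengths lie, in order, below
    \<open>(l + 1, 0)\<close>, on the antidiagonal \<open>l + 1\<close>, and from
    \<open>(0, l + 1)\<close> upwards.\<close>
  have T: "(2 * r + 2) * Suc l = H + 2 * r + 2" and V: "(2 * r + 1) * Suc l + l = H + 2 * r + 1"
    by (simp_all add: H_def algebra_simps)
  consider "d \<le> H + r" | "H + r < d" "d + l < H + 2 * r + 1"
    | "H + 2 * r + 1 \<le> d + l" "d \<le> H + 2 * r + 1" | "H + 2 * r + 2 \<le> d"
    by linarith
  then show ?case
  proof cases
    case 1
    then show ?thesis using Suc by (simp add: H_def)
  next
    case 2
    define e where "e = H + 2 * r + 1 - (d + l)"
    have "e \<le> r" "e + (d + l) = H + 2 * r + 1"
      using 2 by (simp_all add: e_def)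
    then have "e + d = (2 * r + 1) * Suc l"
      using V by linarith
    with \<open>e \<le> r\<close> show ?thesis
      using Suc.prems(1) by (intro measures_lower1)
  next
    case 3
    then show ?thesis
      using Suc.prems T
      by (intro measures_diagonal[of d "H + 2 * r + 2 - d" "Suc l"]) linarith+
  next
    case 4
    then have "d - (H + 2 * r + 2) \<le> r" "H + 2 * r + 2 + (d - (H + 2 * r + 2)) = d"
      using Suc.prems T by linarith+
    then show ?thesis
      using measures_upper1[OF Suc.prems(1), of "d - (H + 2 * r + 2)"] by (simp only: T)
  qed
qed

text \<open>Only every second antidiagonal ends in lattice points of the slanted edges, so each step
  crosses two. The first continues directly after \<open>H + r\<close>; the gap between the two is
  filled from below \<open>(r + 2 + c, c + 1)\<close>, whose value is given by
  \<open>V\<close>.\<close>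

lemma measures_sweep2:
  "c \<le> s \<Longrightarrow> d \<le> (2 * r + 1) * c + (2 * r + 2) * (r + 1 + c) + r \<Longrightarrow> measures R d"
proof (induction c)
  case 0
  then show ?case using measures_sweep1[of "r + 1" d] by simp
next
  case (Suc c)
  define H where "H = (2 * r + 1) * c + (2 * r + 2) * (r + 1 + c)"
  have T1: "(2 * r + 2) * (r + 2 * c + 2) = H + c + 2 * r + 2"
    and T2: "(2 * r + 2) * (r + 2 * c + 3) = H + c + 4 * r + 4"
    and U: "(2 * r + 1) * Suc c + (2 * r + 2) * (r + 1 + Suc c) = H + 4 * r + 3"
    and V: "(2 * r + 1) * (r + 1 + Suc c) + (2 * r + 2) * Suc c = H + 3 * r + 2"
    by (simp_all add: H_def algebra_simps)
  consider "d \<le> H + r" | "H + r < d" "d \<le> H + 2 * r + 1" | "H + 2 * r + 2 \<le> d" "d < H + 3 * r + 2"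
    | "H + 3 * r + 2 \<le> d" "d \<le> H + 4 * r + 3" | "H + 4 * r + 3 < d"
    by linarith
  then show ?case
  proof cases
    case 1
    then show ?thesis using Suc by (simp add: H_def)
  next
    case 2
    then show ?thesis
      using Suc.prems T1
      by (intro measures_diagonal[of d "H + c + 2 * r + 2 - d" "r + 2 * c + 2"]) linarith+
  next
    case 3
    then show ?thesis
      using Suc.prems V by (intro measures_lower2[of "Suc c" "H + 3 * r + 2 - d"]) linarith+
  next
    case 4
    then show ?thesis
      using Suc.prems T2
      by (intro measures_diagonal[of d "H + c + 4 * r + 4 - d" "r + 2 * c + 3"]) linarith+
  next
    case 5
    then have "d - (H + 4 * r + 3) \<le> r" "H + 4 * r + 3 + (d - (H + 4 * r + 3)) = d"
      using Suc.prems U by linarith+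
    then show ?thesis
      using measures_upper2[OF Suc.prems(1), of "d - (H + 4 * r + 3)"] unfolding U by simp
  qed
qed

text \<open>Along the top edge, the gap before the next antidiagonal is filled from below
  \<open>(r + 1 + s, s + v + 1)\<close>. It needs only \<open>e\<close> up to \<open>v\<close>, and
  \<open>v\<close> is at most \<open>r\<close> in the step.\<close>

lemma measures_sweep3:
  "v \<le> r + 1 \<Longrightarrow> d \<le> (2 * r + 1) * (s + v) + (2 * r + 2) * (r + 1 + s) + r \<Longrightarrow> measures R d"
proof (induction v)
  case 0
  then show ?case using measures_sweep2[of s d] by simp
next
  case (Suc v)
  define H where "H = (2 * r + 1) * (s + v) + (2 * r + 2) * (r + 1 + s)"
  have T: "(2 * r + 2) * (r + 2 + 2 * s + v) = H + 2 * r + 2 + s + v"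
    and U: "(2 * r + 1) * (s + Suc v) + (2 * r + 2) * (r + 1 + s) = H + 2 * r + 1"
    and V: "(2 * r + 1) * (r + 1 + s) + (2 * r + 2) * (s + Suc v) = H + v + r + 1"
    by (simp_all add: H_def algebra_simps)
  consider "d \<le> H + r" | "H + r < d" "d \<le> H + v + r + 1"
    | "H + v + r + 1 < d" "d \<le> H + 2 * r + 1" | "H + 2 * r + 1 < d"
    by linarith
  then show ?case
  proof cases
    case 1
    then show ?thesis using Suc by (simp add: H_def)
  next
    case 2
    then show ?thesis
      using Suc.prems V by (intro measures_lower3[of "Suc v" "H + v + r + 1 - d"]) linarith+
  next
    case 3
    then show ?thesis
      using Suc.prems T
      by (intro measures_diagonal[of d "H + 2 * r + 2 + s + v - d" "r + 2 + 2 * s + v"]) linarith+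
  next
    case 4
    then have "d - (H + 2 * r + 1) \<le> r" "H + 2 * r + 1 + (d - (H + 2 * r + 1)) = d"
      using Suc.prems U by linarith+
    then show ?thesis
      using measures_upper3[OF Suc.prems(1), of "d - (H + 2 * r + 1)"] unfolding U by simp
  qed
qed

text \<open>A length \<open>d\<close> above \<open>n\<close> is measured from the unit mark
  \<open>t - d\<close> to \<open>t\<close>.\<close>

lemma measures_mark_extension:
  assumes "\<And>d. d \<le> n \<Longrightarrow> measures R d" "t \<in> R" "t \<le> n + r + 1" "d \<le> t"
  shows "measures R d"
proof (cases "d \<le> n")
  case False
  then show ?thesis
    using assms(2-) by (intro measuresI[OF unit1[of "t - d"] assms(2)]) auto
qed (use assms(1) in blast)

end

section \<open>Marks and completeness of the extended Wichmann ruler\<close>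

lemma wichmann_marks_extended: "wichmann_marks r s (extended_wichmann_ruler r s i j)"
proof
  let ?R = "extended_wichmann_ruler r s i j"
  note simps = extended_wichmann_ruler_def wichmann_diffs_def sum_list_replicate
  show "e \<in> ?R" if "e \<le> r" for e
    using ruler_of_diffs_block[OF that, of "[]" 1] by (simp add: simps)
  show "k * (2 * r + 1) \<in> ?R" if "k \<le> r + 1" for k
  proof (cases k)
    case 0
    then show ?thesis using ruler_of_diffs_block[of 0 r "[]" 1] by (simp add: simps)
  next
    \<comment> \<open>The first \<open>r\<close> unit steps and the step \<open>r + 1\<close>
      together have length \<open>2 * r + 1\<close>, so \<open>k'\<close> further steps lead to the
      mark with index \<open>k\<close>.\<close>
    case (Suc k')
    then show ?thesis
      using that ruler_of_diffs_block[of k' r "replicate r 1 @ [r + 1]" "2 * r + 1"]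
      by (simp add: simps algebra_simps)
  qed
  show "(r + 1) * (2 * r + 1) + c * (4 * r + 3) \<in> ?R" if "c \<le> s" for c
    using ruler_of_diffs_block[OF that,
        of "replicate r 1 @ [r + 1] @ replicate r (2 * r + 1)" "4 * r + 3"]
    by (simp add: simps algebra_simps)
  show "(r + 1) * (2 * r + 1) + s * (4 * r + 3) + k * (2 * r + 2) \<in> ?R" if "k \<le> r + 1" for k
    using ruler_of_diffs_block[OF that,
        of "replicate r 1 @ [r + 1] @ replicate r (2 * r + 1) @ replicate s (4 * r + 3)"
          "2 * r + 2"]
    by (simp add: simps algebra_simps)
  show "(r + 1) * (2 * r + 1) + s * (4 * r + 3) + (r + 1) * (2 * r + 2) + e \<in> ?R"
    if "e \<le> r" for e
    using ruler_of_diffs_block[OF that,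
        of "replicate r 1 @ [r + 1] @ replicate r (2 * r + 1) @ replicate s (4 * r + 3) @
          replicate (r + 1) (2 * r + 2)" 1]
    by (simp add: simps algebra_simps)
qed

theorem theorem5:
  fixes r s i j :: nat
  assumes "j \<le> r + 1"
  shows "complete_sparse_ruler (sum_list (wichmann_diffs r s i j)) (extended_wichmann_ruler r s i j)"
proof -
  let ?R = "extended_wichmann_ruler r s i j"
  let ?bs = "replicate r 1 @ [r + 1] @ replicate r (2 * r + 1) @ replicate s (4 * r + 3) @
     replicate (r + 1) (2 * r + 2) @ replicate r 1"
  interpret wichmann_marks r s ?R by (rule wichmann_marks_extended)
  have sparse: "sparse_ruler (sum_list (wichmann_diffs r s i j)) ?R"
    unfolding extended_wichmann_ruler_def by (rule sparse_ruler_of_diffs)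
  have mark: "sum_list ?bs + k * (r + 1) \<in> ?R" if "k \<le> i" for k
    using ruler_of_diffs_block[OF that, of ?bs "r + 1" "[j]"]
    by (simp add: extended_wichmann_ruler_def wichmann_diffs_def)
  \<comment> \<open>The end of the second unit run is the value of the top corner
    \<open>(s + r + 1, s + r + 1)\<close> plus \<open>r\<close>, exactly where the sweep
    stops.\<close>
  have "sum_list ?bs = (2 * r + 1) * (s + (r + 1)) + (2 * r + 2) * (r + 1 + s) + r"
    by (simp add: sum_list_replicate algebra_simps)
  then have base: "measures ?R d" if "d \<le> sum_list ?bs" for d
    using measures_sweep3[of "r + 1" d] that by (simp only: order_refl)
  have steps: "k \<le> i \<Longrightarrow> d \<le> sum_list ?bs + k * (r + 1) \<Longrightarrow> measures ?R d" for k d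
  proof (induction k arbitrary: d)
    case 0
    then show ?case using base by simp
  next
    case (Suc k)
    show ?case
      by (rule measures_mark_extension[OF Suc.IH mark[OF Suc.prems(1)] _ Suc.prems(2)])
        (use Suc.prems(1) in auto)
  qed
  have total: "sum_list (wichmann_diffs r s i j) = sum_list ?bs + i * (r + 1) + j"
    by (simp add: wichmann_diffs_def sum_list_replicate)
  show ?thesis
  proof (rule complete_sparse_rulerI[OF sparse])
    fix d assume "d \<le> sum_list (wichmann_diffs r s i j)"
    moreover have "sum_list (wichmann_diffs r s i j) \<in> ?R"
      using sparse by (simp add: sparse_ruler_def)
    \<comment> \<open>The last step \<open>j\<close> is at most \<open>r + 1\<close>, so the end
      mark is within reach of one more extension.\<close>
    ultimately show "measures ?R d"
      using measures_mark_extension[OF steps[OF order_refl]] assms total by simp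
  qed
qed

end
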